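(* Suppose $\mathfrak s,\mathfrak t\in\mathbb R$. If $1\le\mathfrak t\le\mathfrak s$ and $\mathfrak s+\mathfrak t\ge3$, then $$\mu_{\mathfrak s,\mathfrak t}:=\frac{\mathfrak s}{\mathfrak s+\mathfrak t}\le m_{\mathfrak s,\mathfrak t}\le\mu_{\mathfrak s,\mathfrak t}+\frac{\mathfrak s-\mathfrak t}{(\mathfrak s+\mathfrak t)^2}.$$
   Context: $m_{\mathfrak s,\mathfrak t}\in[0,1]$ denotes the median of the Beta$(\mathfrak s,\mathfrak t)$ distribution (density $x^{\mathfrak s-1}(1-x)^{\mathfrak t-1}/B(\mathfrak s,\mathfrak t)$ on $[0,1]$), i.e. the unique point with $I_{m_{\mathfrak s,\mathfrak t}}(\mathfrak s,\mathfrak t)=\frac12$, where $I_x(\mathfrak s,\mathfrak t)$ is the regularized incomplete beta function. *)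

theory Defs
  imports "HOL-Analysis.Analysis"
begin

text \<open>
  The Beta distribution with parameters \<open>s, t > 0\<close>, supported on the unit interval.
  Since \<open>0 powr a = 0\<close> for every \<open>a\<close>, including \<open>a = 0\<close>, the value of the density at the
  endpoints 0 and 1 may differ from the usual one; this does not affect any integral.
\<close>

definition beta_density :: "real \<Rightarrow> real \<Rightarrow> real \<Rightarrow> real" where
  "beta_density s t x = x powr (s - 1) * (1 - x) powr (t - 1) / Beta s t"

text \<open>
  The regularized incomplete beta function \<open>I\<^sub>x(s, t)\<close>, i.e. the distribution function of
  the Beta distribution. Only meaningful for \<open>0 \<le> x \<le> 1\<close>: \<open>beta_density\<close> is not cut off to 0
  outside the unit interval.
\<close>

definition reg_inc_beta :: "real \<Rightarrow> real \<Rightarrow> real \<Rightarrow> real" where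
  "reg_inc_beta x s t = integral {0..x} (beta_density s t)"

text \<open>
  For \<open>s, t > 0\<close> the function \<open>\<lambda>x. reg_inc_beta x s t\<close> increases continuously and strictly
  from 0 to 1 on the unit interval, so the description below denotes a unique point.
\<close>

definition beta_median :: "real \<Rightarrow> real \<Rightarrow> real" where
  "beta_median s t = (THE m. m \<in> {0..1} \<and> reg_inc_beta m s t = 1 / 2)"

end

theory Submission
  imports Defs
begin

text \<open>
  Write \<open>n = s + t\<close> and let \<open>F\<close> be the distribution function of the Beta distribution. The upper
  bound is obtained through the point \<open>c = (s - 1/2) / (n - 1)\<close>, so that what has to be shown is
  \<open>F (s/n) \<le> 1/2\<close> and \<open>1/2 \<le> F c\<close>. Both follow from one idea: change the variable so that the point in
  question becomes the mode of the transformed density, and compare that density at the two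
  places at equal distance from the mode. If it is never smaller at the right-hand place, at least half
  of the mass lies to the right of the mode; if it is never larger there, at least half lies to
  the left.

  Under \<open>dx = (x (1 - x))\<^sup>a dy\<close> the density in \<open>y\<close> is proportional to
  \<open>x powr (s - 1 + a) * (1 - x) powr (t - 1 + a)\<close>, whose mode is at
  \<open>x = (s - 1 + a) / (n - 2 + 2 a)\<close>.

  For \<open>a = 1\<close> (the logit scale) the mode is the mean \<open>s/n\<close>. When \<open>t \<le> s\<close>, the density in \<open>y\<close> to
  the right of the mode is at least that at the mirror point on the left: this is \<open>logit_reflection_inequality\<close>.

  For \<open>a = 1/2\<close> (the arcsine scale \<open>x = (sin \<theta>)\<^sup>2\<close>) the mode is \<open>c\<close>. When \<open>t \<le> s\<close>, the
  density in \<open>\<theta>\<close> to the right of the mode is at most that at the mirror point on the left: this is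
  \<open>arcsine_reflection_inequality\<close>. This gives the upper bound,
  because \<open>c = s/n + (s - t) / (2 n (n - 1))\<close> and \<open>n\<^sup>2 \<le> 2 n (n - 1)\<close>.

  Instead of substituting in integrals, the proofs let two points move apart from the mode at
  equal speed on the transformed scale, and follow the sum of the values of \<open>F\<close> at them
  (\<open>reg_inc_beta_add_antimono\<close>). At the start this sum is twice the value at the mode; at the end,
  where the right-hand point has reached 1, it is 1 plus the mass left of the other point.
\<close>

section \<open>The distribution function and its median\<close>

lemma Beta_real_pos:
  fixes s t :: real
  assumes "0 < s" "0 < t"
  shows "0 < Beta s t"
  using assms by (simp add: Beta_def)

lemma has_integral_beta_density:
  assumes "0 < s" "0 < t"
  shows "(beta_density s t has_integral 1) {0..1}"
  using has_integral_divide[OF has_integral_Beta_real[OF assms], of "Beta s t"] 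
    Beta_real_pos[OF assms]
  by (simp add: beta_density_def[abs_def])

lemma beta_density_integrable:
  assumes "0 < s" "0 < t"
  shows "beta_density s t integrable_on {0..1}"
  using has_integral_beta_density[OF assms] by blast

lemma reg_inc_beta_0: "reg_inc_beta 0 s t = 0"
  by (simp add: reg_inc_beta_def)

lemma reg_inc_beta_1:
  assumes "0 < s" "0 < t"
  shows "reg_inc_beta 1 s t = 1"
  using has_integral_beta_density[OF assms] by (simp add: reg_inc_beta_def integral_unique)

lemma continuous_on_reg_inc_beta:
  assumes "0 < s" "0 < t"
  shows "continuous_on {0..1} (\<lambda>x. reg_inc_beta x s t)"
  unfolding reg_inc_beta_def
  by (rule indefinite_integral_continuous_1[OF beta_density_integrable[OF assms]])

lemma reg_inc_beta_has_real_derivative: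
  assumes "0 < s" "0 < t" "0 < x" "x < 1"
  shows "((\<lambda>x. reg_inc_beta x s t) has_real_derivative beta_density s t x) (at x)"
proof -
  have "isCont (beta_density s t) x"
    unfolding beta_density_def[abs_def]
    using assms Beta_real_pos[OF assms(1,2)] by (intro continuous_intros) auto
  then have "continuous (at x within {0..1} - {}) (beta_density s t)"
    by (rule continuous_at_imp_continuous_at_within)
  from integral_has_vector_derivative_continuous_at[OF beta_density_integrable[OF assms(1,2)] _ _ this]
  have "((\<lambda>u. integral {0..u} (beta_density s t)) has_vector_derivative beta_density s t x)
      (at x within {0..1})"
    using assms by simp
  moreover have "at x within {0..1} = at x"
    using assms by (intro at_within_interior) auto
  ultimately show ?thesis
    by (simp add: reg_inc_beta_def has_real_derivative_iff_has_vector_derivative)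
qed

lemma reg_inc_beta_strict_mono:
  assumes "0 < s" "0 < t" "0 \<le> x" "x < y" "y \<le> 1"
  shows "reg_inc_beta x s t < reg_inc_beta y s t"
proof (rule DERIV_pos_imp_increasing_open[OF \<open>x < y\<close>])
  fix z assume "x < z" "z < y"
  then have z: "0 < z" "z < 1" using assms by auto
  then have "0 < beta_density s t z"
    using Beta_real_pos[OF assms(1,2)] by (simp add: beta_density_def)
  with reg_inc_beta_has_real_derivative[OF assms(1,2) z]
  show "\<exists>d. ((\<lambda>x. reg_inc_beta x s t) has_real_derivative d) (at z) \<and> 0 < d"
    by blast
next
  show "continuous_on {x..y} (\<lambda>x. reg_inc_beta x s t)"
    using assms by (intro continuous_on_subset[OF continuous_on_reg_inc_beta]) auto
qed

lemma beta_median_works: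
  assumes "0 < s" "0 < t"
  shows "beta_median s t \<in> {0..1} \<and> reg_inc_beta (beta_median s t) s t = 1 / 2"
  unfolding beta_median_def
proof (rule theI')
  have "\<exists>m\<ge>0. m \<le> 1 \<and> reg_inc_beta m s t = 1 / 2"
    using assms
    by (intro IVT') (auto simp: reg_inc_beta_0 reg_inc_beta_1 continuous_on_reg_inc_beta)
  moreover have "x = y" if "x \<in> {0..1}" "y \<in> {0..1}"
      "reg_inc_beta x s t = 1 / 2" "reg_inc_beta y s t = 1 / 2" for x y
    using reg_inc_beta_strict_mono[OF assms, of x y] reg_inc_beta_strict_mono[OF assms, of y x] that
    by (cases x y rule: linorder_cases) auto
  ultimately show "\<exists>!m. m \<in> {0..1} \<and> reg_inc_beta m s t = 1 / 2"
    by (metis atLeastAtMost_iff)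
qed

lemma le_beta_medianI:
  assumes "0 < s" "0 < t" "x \<le> 1" "reg_inc_beta x s t \<le> 1 / 2"
  shows "x \<le> beta_median s t"
  using reg_inc_beta_strict_mono[OF assms(1,2), of "beta_median s t" x]
    beta_median_works[OF assms(1,2)] assms(3,4) by force

lemma beta_median_leI:
  assumes "0 < s" "0 < t" "0 \<le> x" "1 / 2 \<le> reg_inc_beta x s t"
  shows "beta_median s t \<le> x"
  using reg_inc_beta_strict_mono[OF assms(1,2), of x "beta_median s t"]
    beta_median_works[OF assms(1,2)] assms(3,4) by force


section \<open>Moving two points apart\<close>

text \<open>
  The left-hand side of the last premise is \<open>Beta s t\<close> times the derivative of the sum of the values
  along the two curves.
  The curves may reach the ends of the unit interval at \<open>a\<close> and \<open>b\<close>, where the density need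
  not be continuous; hence derivatives are taken only for parameters strictly in between.
\<close>

lemma reg_inc_beta_add_antimono:
  fixes p q p' q' :: "real \<Rightarrow> real"
  assumes "0 < s" "0 < t" "a \<le> b"
    and cont: "continuous_on {a..b} p" "continuous_on {a..b} q"
    and range: "p ` {a..b} \<subseteq> {0..1}" "q ` {a..b} \<subseteq> {0..1}"
    and inner: "\<And>u. a < u \<Longrightarrow> u < b \<Longrightarrow> p u \<in> {0<..<1} \<and> q u \<in> {0<..<1}"
    and deriv: "\<And>u. a < u \<Longrightarrow> u < b \<Longrightarrow> (p has_real_derivative p' u) (at u)"
      "\<And>u. a < u \<Longrightarrow> u < b \<Longrightarrow> (q has_real_derivative q' u) (at u)"
    and le: "\<And>u. a < u \<Longrightarrow> u < b \<Longrightarrow>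
      p u powr (s - 1) * (1 - p u) powr (t - 1) * p' u
      + q u powr (s - 1) * (1 - q u) powr (t - 1) * q' u \<le> 0"
  shows "reg_inc_beta (p b) s t + reg_inc_beta (q b) s t
    \<le> reg_inc_beta (p a) s t + reg_inc_beta (q a) s t"
proof (rule DERIV_nonpos_imp_decreasing_open[OF \<open>a \<le> b\<close>])
  fix u assume u: "a < u" "u < b"
  have "((\<lambda>u. reg_inc_beta (p u) s t + reg_inc_beta (q u) s t) has_real_derivative
      beta_density s t (p u) * p' u + beta_density s t (q u) * q' u) (at u)"
    using inner[OF u]
    by (intro DERIV_add DERIV_chain2[OF reg_inc_beta_has_real_derivative] deriv u assms(1,2)) auto
  moreover have "beta_density s t (p u) * p' u + beta_density s t (q u) * q' u \<le> 0"
    using divide_right_mono[OF le[OF u], of "Beta s t"] Beta_real_pos[OF assms(1,2)]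
    by (simp add: beta_density_def add_divide_distrib)
  ultimately show "\<exists>d. ((\<lambda>u. reg_inc_beta (p u) s t + reg_inc_beta (q u) s t)
      has_real_derivative d) (at u) \<and> d \<le> 0"
    by blast
next
  show "continuous_on {a..b} (\<lambda>u. reg_inc_beta (p u) s t + reg_inc_beta (q u) s t)"
    by (intro continuous_on_add
        continuous_on_compose2[OF continuous_on_reg_inc_beta] assms(1,2) cont range)
qed


section \<open>The mean is a lower bound\<close>

text \<open>
  The points with odds \<open>s / (t w)\<close> and \<open>s w / t\<close> have logits at distance \<open>- ln w\<close> on either side of
  the logit of the mean. The claim is that \<open>s ln x + t ln (1 - x)\<close>, the logarithm of the density on
  the logit scale up to a constant, is at least as large at the right-hand point as at the left-hand
  one. There is equality for \<open>w = 1\<close>, and the derivative in \<open>w\<close> of the difference of the two sides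
  has a perfect square as a factor.
\<close>

lemma logit_reflection_inequality:
  fixes s t w :: real
  assumes "0 < t" "t \<le> s" "0 < w" "w \<le> 1"
  shows "(s - t) * ln w + (s + t) * ln (s + t * w) \<le> (s + t) * ln (s * w + t)"
proof -
  define g where "g = (\<lambda>w. (s - t) * ln w + (s + t) * ln (s + t * w) - (s + t) * ln (s * w + t))"
  have "g w \<le> g 1"
  proof (rule DERIV_nonneg_imp_nondecreasing[OF \<open>w \<le> 1\<close>])
    fix x assume "w \<le> x" "x \<le> 1"
    with assms have x: "0 < x" by simp
    have pos: "0 < s + t * x" "0 < s * x + t"
      using assms x by (auto intro!: add_pos_pos add_nonneg_pos)
    have "(g has_real_derivative
        (s - t) / x + (s + t) * (t / (s + t * x)) - (s + t) * (s / (s * x + t))) (at x)"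
      unfolding g_def using x pos by (auto intro!: derivative_eq_intros simp: mult.commute)
    moreover have "(s - t) / x + (s + t) * (t / (s + t * x)) - (s + t) * (s / (s * x + t))
        = (s - t) * (s * t) * (x - 1)\<^sup>2 / (x * (s + t * x) * (s * x + t))"
      using x pos by (simp add: divide_simps) (simp add: algebra_simps power2_eq_square)
    moreover have "0 \<le> (s - t) * (s * t) * (x - 1)\<^sup>2 / (x * (s + t * x) * (s * x + t))"
      using x pos assms by (intro divide_nonneg_nonneg mult_nonneg_nonneg) auto
    ultimately show "\<exists>d. (g has_real_derivative d) (at x) \<and> 0 \<le> d"
      by auto
  qed
  then show ?thesis
    by (simp add: g_def add.commute)
qed

text \<open>
  The odds of the two points are those of the mean divided and multiplied by \<open>w\<close>. Compared with the
  distance on the logit scale, the parameter \<open>w\<close> has a bounded range, so no limit has to be taken: as \<open>w\<close> goes from 1 down to 0, the points move from the mean to 1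
  and 0, and the sum of the two values grows from twice the value at the mean to 1.
\<close>

lemma reg_inc_beta_mean_le:
  assumes "0 < t" "t \<le> s"
  shows "reg_inc_beta (s / (s + t)) s t \<le> 1 / 2"
proof -
  have s: "0 < s" using assms by simp
  define p q where "p = (\<lambda>w. s / (s + t * w))" and "q = (\<lambda>w. s * w / (s * w + t))"
  have pos: "0 < s + t * w" "0 < s * w + t" if "0 \<le> w" for w
    using mult_nonneg_nonneg[of t w] mult_nonneg_nonneg[of s w] assms s that by linarith+
  have "reg_inc_beta (p 1) s t + reg_inc_beta (q 1) s t
      \<le> reg_inc_beta (p 0) s t + reg_inc_beta (q 0) s t"
  proof (rule reg_inc_beta_add_antimono[OF s \<open>0 < t\<close>,
        where p' = "\<lambda>w. - (p w * (1 - p w) / w)" and q' = "\<lambda>w. q w * (1 - q w) / w"])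
    show "continuous_on {0..1} p" "continuous_on {0..1} q"
      unfolding p_def q_def by (intro continuous_intros; use pos in force)+
    show "p ` {0..1} \<subseteq> {0..1}" "q ` {0..1} \<subseteq> {0..1}"
      unfolding p_def q_def using pos s assms by (auto simp: divide_simps)
  next
    fix w :: real assume w: "0 < w" "w < 1"
    note pos = pos[OF less_imp_le[OF w(1)]]
    show rng: "p w \<in> {0<..<1} \<and> q w \<in> {0<..<1}"
      using w s assms pos by (auto simp: p_def q_def divide_simps)
    show "(p has_real_derivative - (p w * (1 - p w) / w)) (at w)"
      unfolding p_def using w pos
      by (auto intro!: derivative_eq_intros simp: divide_simps)
    show "(q has_real_derivative q w * (1 - q w) / w) (at w)"
      unfolding q_def using w pos
      by (auto intro!: derivative_eq_intros simp: divide_simps) (simp add: algebra_simps)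
    \<comment> \<open>The factor \<open>x * (1 - x)\<close> turns the density into the one on the logit scale.\<close>
    have K: "x powr (s - 1) * (1 - x) powr (t - 1) * (x * (1 - x) / w)
        = exp (s * ln x + t * ln (1 - x)) / w" if "x \<in> {0<..<1}" for x
      using that w by (simp add: powr_def left_diff_distrib exp_diff exp_add)
    have 1: "1 - p w = t * w / (s + t * w)" "1 - q w = t / (s * w + t)"
      using pos by (auto simp: p_def q_def divide_simps)
    have "s * ln (q w) + t * ln (1 - q w) \<le> s * ln (p w) + t * ln (1 - p w)"
      unfolding 1 using logit_reflection_inequality[OF assms w(1) less_imp_le[OF w(2)]] w s assms pos
      by (simp add: p_def q_def ln_mult ln_div algebra_simps)
    then have "exp (s * ln (q w) + t * ln (1 - q w)) / w \<le> exp (s * ln (p w) + t * ln (1 - p w)) / w"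
      using w by (simp add: divide_right_mono)
    then show "p w powr (s - 1) * (1 - p w) powr (t - 1) * (- (p w * (1 - p w) / w))
        + q w powr (s - 1) * (1 - q w) powr (t - 1) * (q w * (1 - q w) / w) \<le> 0"
      using K[of "p w"] K[of "q w"] rng w by simp
  qed simp
  then show ?thesis
    using s assms by (simp add: p_def q_def reg_inc_beta_0 reg_inc_beta_1)
qed


section \<open>An upper bound between mean and mode\<close>

text \<open>
  On the arcsine scale the logarithm of the density is \<open>\<alpha> ln (sin x) + \<beta> ln (cos x)\<close> up to a constant,
  with \<open>\<alpha> = 2 s - 1\<close> and \<open>\<beta> = 2 t - 1\<close>; that \<open>\<theta>\<close> is its mode means that \<open>\<alpha>\<close> and \<open>\<beta>\<close> are proportional to
  \<open>S = (sin \<theta>)\<^sup>2\<close> and \<open>C = (cos \<theta>)\<^sup>2\<close>. With \<open>v = (sin u)\<^sup>2\<close>, the derivative in \<open>u\<close> of the difference of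
  the two sides is a nonnegative multiple of \<open>S / (S - v) - C / (C - v)\<close>, because the sums of the
  cotangents and of the tangents at \<open>\<theta> + u\<close> and \<open>\<theta> - u\<close> have the same numerator \<open>sin (2 \<theta>)\<close>. This is
  not positive as \<open>C \<le> S\<close>, the mode being at least \<open>pi / 4\<close>.
\<close>

lemma arcsine_reflection_inequality:
  fixes \<theta> u \<kappa> :: real
  assumes \<theta>: "pi / 4 \<le> \<theta>" and u: "0 \<le> u" "\<theta> + u < pi / 2" and \<kappa>: "0 \<le> \<kappa>"
  defines "\<alpha> \<equiv> \<kappa> * (sin \<theta>)\<^sup>2" and "\<beta> \<equiv> \<kappa> * (cos \<theta>)\<^sup>2"
  shows "\<alpha> * ln (sin (\<theta> + u)) + \<beta> * ln (cos (\<theta> + u))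
    \<le> \<alpha> * ln (sin (\<theta> - u)) + \<beta> * ln (cos (\<theta> - u))"
proof -
  define g where "g = (\<lambda>u. \<alpha> * ln (sin (\<theta> + u)) + \<beta> * ln (cos (\<theta> + u))
    - (\<alpha> * ln (sin (\<theta> - u)) + \<beta> * ln (cos (\<theta> - u))))"
  have "g u \<le> g 0"
  proof (rule DERIV_nonpos_imp_nonincreasing[OF \<open>0 \<le> u\<close>])
    fix x assume x: "0 \<le> x" "x \<le> u"
    have pos: "0 < sin (\<theta> + x)" "0 < cos (\<theta> + x)" "0 < sin (\<theta> - x)" "0 < cos (\<theta> - x)"
      using x u \<theta> by (auto intro!: sin_gt_zero cos_gt_zero_pi)
    define S C v where "S = (sin \<theta>)\<^sup>2" and "C = (cos \<theta>)\<^sup>2" and "v = (sin x)\<^sup>2"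
    have SC: "S + C = 1" by (simp add: S_def C_def)
    have prod_sin: "sin (\<theta> + x) * sin (\<theta> - x) = S - v"
      unfolding S_def v_def sin_add sin_diff
      by (simp add: algebra_simps power2_eq_square)
        (use sin_cos_squared_add[of x] sin_cos_squared_add[of \<theta>] in algebra)
    have prod_cos: "cos (\<theta> + x) * cos (\<theta> - x) = C - v"
      unfolding C_def v_def cos_add cos_diff
      by (simp add: algebra_simps power2_eq_square)
        (use sin_cos_squared_add[of x] sin_cos_squared_add[of \<theta>] in algebra)
    have vC: "v < C" and vS: "v < S"
      using mult_pos_pos[OF pos(2,4)] mult_pos_pos[OF pos(1,3)] by (auto simp: prod_sin prod_cos)
    have cot_sum: "cos (\<theta> + x) / sin (\<theta> + x) + cos (\<theta> - x) / sin (\<theta> - x) = sin (2 * \<theta>) / (S - v)"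
      using pos sin_add[of "\<theta> + x" "\<theta> - x"]
      by (simp add: prod_sin[symmetric] add_frac_eq algebra_simps)
    have tan_sum: "sin (\<theta> + x) / cos (\<theta> + x) + sin (\<theta> - x) / cos (\<theta> - x) = sin (2 * \<theta>) / (C - v)"
      using pos sin_add[of "\<theta> + x" "\<theta> - x"]
      by (simp add: prod_cos[symmetric] add_frac_eq algebra_simps)
    have CS: "C \<le> S"
    proof -
      have "cos (2 * \<theta>) \<le> 0"
        using cos_monotone_0_pi_le[of "pi / 2" "2 * \<theta>"] \<theta> u by simp
      then show ?thesis by (simp add: cos_double S_def C_def)
    qed
    have "(g has_real_derivative
        \<alpha> * (cos (\<theta> + x) / sin (\<theta> + x) + cos (\<theta> - x) / sin (\<theta> - x))
        - \<beta> * (sin (\<theta> + x) / cos (\<theta> + x) + sin (\<theta> - x) / cos (\<theta> - x))) (at x)"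
      unfolding g_def using pos
      by (auto intro!: derivative_eq_intros simp: algebra_simps)
    moreover have "S / (S - v) \<le> C / (C - v)"
    proof -
      have "C * v \<le> S * v" using CS by (simp add: v_def mult_right_mono)
      then show ?thesis using vC vS by (simp add: divide_simps algebra_simps)
    qed
    then have "\<kappa> * sin (2 * \<theta>) * (S / (S - v)) \<le> \<kappa> * sin (2 * \<theta>) * (C / (C - v))"
      using \<kappa> \<theta> u by (intro mult_left_mono mult_nonneg_nonneg sin_ge_zero) auto
    then have "\<alpha> * (cos (\<theta> + x) / sin (\<theta> + x) + cos (\<theta> - x) / sin (\<theta> - x))
        - \<beta> * (sin (\<theta> + x) / cos (\<theta> + x) + sin (\<theta> - x) / cos (\<theta> - x)) \<le> 0"
      unfolding cot_sum tan_sum \<alpha>_def \<beta>_def S_def[symmetric] C_def[symmetric]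
      by (simp add: mult_ac)
    ultimately show "\<exists>d. (g has_real_derivative d) (at x) \<and> d \<le> 0"
      by blast
  qed
  then show ?thesis by (simp add: g_def)
qed

text \<open>
  The two points are \<open>(sin (\<theta> + u))\<^sup>2\<close> and \<open>(sin (\<theta> - u))\<^sup>2\<close>. Since \<open>\<theta>\<close> is at least \<open>pi / 4\<close>, the right-hand
  one reaches 1 no later than the left-hand one reaches 0; what is left of the left tail
  at that moment only helps.
\<close>

lemma reg_inc_beta_arcsine_mode_ge:
  assumes "1 / 2 < t" "t \<le> s"
  shows "1 / 2 \<le> reg_inc_beta ((2 * s - 1) / (2 * (s + t - 1))) s t"
proof -
  define c where "c = (2 * s - 1) / (2 * (s + t - 1))"
  define \<kappa> where "\<kappa> = 2 * (s + t - 1)"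
  have s: "0 < s" and t: "0 < t" and \<kappa>: "0 < \<kappa>" using assms by (auto simp: \<kappa>_def)
  have c: "1 / 2 \<le> c" "c < 1" using assms by (auto simp: c_def divide_simps)
  have sqrt_c: "0 \<le> sqrt c" "- 1 \<le> sqrt c" "sqrt c \<le> 1"
  proof -
    show "0 \<le> sqrt c" "sqrt c \<le> 1" using c by auto
    then show "- 1 \<le> sqrt c" by linarith
  qed
  define \<theta> where "\<theta> = arcsin (sqrt c)"
  have sin_\<theta>: "(sin \<theta>)\<^sup>2 = c"
    using c sqrt_c by (simp add: \<theta>_def)
  have cos_\<theta>: "(cos \<theta>)\<^sup>2 = 1 - c"
    using sin_\<theta> by (simp add: cos_squared_eq)
  have \<theta>: "pi / 4 \<le> \<theta>" "\<theta> < pi / 2"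
  proof -
    have 0: "0 \<le> \<theta>" "\<theta> \<le> pi / 2"
      using arcsin_le_arcsin[of 0 "sqrt c"] arcsin_bounded[of "sqrt c"] sqrt_c
      by (auto simp: \<theta>_def)
    have "\<theta> \<noteq> pi / 2"
    proof
      assume "\<theta> = pi / 2"
      then have "sin \<theta> = 1" by (simp only: sin_pi_half)
      then show False using sin_\<theta> c by simp
    qed
    then show "\<theta> < pi / 2" using 0 by simp
    have "cos (2 * \<theta>) \<le> 0" using c by (simp add: cos_double sin_\<theta> cos_\<theta>)
    then show "pi / 4 \<le> \<theta>"
      using cos_gt_zero_pi[of "2 * \<theta>"] 0 by linarith
  qed
  have weights: "2 * s - 1 = \<kappa> * (sin \<theta>)\<^sup>2" "2 * t - 1 = \<kappa> * (cos \<theta>)\<^sup>2"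
    unfolding sin_\<theta> cos_\<theta> c_def \<kappa>_def using assms by (auto simp: divide_simps)
  define p q where "p = (\<lambda>u. (sin (\<theta> + u))\<^sup>2)" and "q = (\<lambda>u. (sin (\<theta> - u))\<^sup>2)"
  define r where "r = pi / 2 - \<theta>"
  have "reg_inc_beta (p r) s t + reg_inc_beta (q r) s t
      \<le> reg_inc_beta (p 0) s t + reg_inc_beta (q 0) s t"
  proof (rule reg_inc_beta_add_antimono[OF s t,
        where p' = "\<lambda>u. 2 * sin (\<theta> + u) * cos (\<theta> + u)"
          and q' = "\<lambda>u. - (2 * sin (\<theta> - u) * cos (\<theta> - u))"])
    show "continuous_on {0..r} p" "continuous_on {0..r} q"
      unfolding p_def q_def by (auto intro!: continuous_intros)
    show "p ` {0..r} \<subseteq> {0..1}" "q ` {0..r} \<subseteq> {0..1}"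
      unfolding p_def q_def by (auto simp: abs_square_le_1)
    show "0 \<le> r" using \<theta> by (simp add: r_def)
  next
    fix u assume u: "0 < u" "u < r"
    have pos: "0 < sin (\<theta> + u)" "0 < cos (\<theta> + u)" "0 < sin (\<theta> - u)" "0 < cos (\<theta> - u)"
      using u \<theta> by (auto simp: r_def intro!: sin_gt_zero cos_gt_zero_pi)
    have "(sin x)\<^sup>2 \<in> {0<..<1}" if "0 < sin x" "0 < cos x" for x :: real
      using that zero_less_power[OF that(2), of 2] by (auto simp: cos_squared_eq)
    then show "p u \<in> {0<..<1} \<and> q u \<in> {0<..<1}"
      unfolding p_def q_def using pos by blast
    show "(p has_real_derivative 2 * sin (\<theta> + u) * cos (\<theta> + u)) (at u)"
      "(q has_real_derivative - (2 * sin (\<theta> - u) * cos (\<theta> - u))) (at u)"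
      unfolding p_def q_def by (auto intro!: derivative_eq_intros)
    \<comment> \<open>The factor \<open>2 * sin x * cos x\<close> turns the density into the one on the arcsine scale.\<close>
    have K: "((sin x)\<^sup>2) powr (s - 1) * (1 - (sin x)\<^sup>2) powr (t - 1) * (2 * sin x * cos x)
        = 2 * exp ((2 * s - 1) * ln (sin x) + (2 * t - 1) * ln (cos x))"
      if "0 < sin x" "0 < cos x" for x
    proof -
      have "((sin x)\<^sup>2) powr (s - 1) = exp ((2 * s - 2) * ln (sin x))"
        "((cos x)\<^sup>2) powr (t - 1) = exp ((2 * t - 2) * ln (cos x))"
        using that by (simp_all add: powr_def ln_realpow algebra_simps)
      moreover have "exp ((2 * s - 1) * ln (sin x)) = exp ((2 * s - 2) * ln (sin x)) * sin x"
        "exp ((2 * t - 1) * ln (cos x)) = exp ((2 * t - 2) * ln (cos x)) * cos x"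
        using that exp_add[of "(2 * s - 2) * ln (sin x)" "ln (sin x)"]
          exp_add[of "(2 * t - 2) * ln (cos x)" "ln (cos x)"]
        by (simp_all add: algebra_simps)
      ultimately show ?thesis
        by (simp add: cos_squared_eq[symmetric] exp_add)
    qed
    have "(2 * s - 1) * ln (sin (\<theta> + u)) + (2 * t - 1) * ln (cos (\<theta> + u))
        \<le> (2 * s - 1) * ln (sin (\<theta> - u)) + (2 * t - 1) * ln (cos (\<theta> - u))"
      unfolding weights using u \<theta> \<kappa> by (intro arcsine_reflection_inequality) (auto simp: r_def)
    then show "p u powr (s - 1) * (1 - p u) powr (t - 1) * (2 * sin (\<theta> + u) * cos (\<theta> + u))
        + q u powr (s - 1) * (1 - q u) powr (t - 1) * (- (2 * sin (\<theta> - u) * cos (\<theta> - u))) \<le> 0"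
      using K[OF pos(1,2)] K[OF pos(3,4)] by (simp add: p_def q_def)
  qed
  moreover have "p r = 1" "p 0 = c" "q 0 = c"
    by (simp_all add: p_def q_def r_def sin_\<theta>)
  moreover have "0 \<le> reg_inc_beta (q r) s t"
  proof (cases "q r = 0")
    case True
    then show ?thesis by (simp add: reg_inc_beta_0)
  next
    case False
    moreover have "0 \<le> q r" "q r \<le> 1" by (simp_all add: q_def abs_square_le_1)
    ultimately show ?thesis
      using reg_inc_beta_strict_mono[OF s t, of 0 "q r"] by (simp add: reg_inc_beta_0)
  qed
  ultimately show ?thesis
    using reg_inc_beta_1[OF s t] by (simp add: c_def)
qed

lemma arcsine_mode_le:
  fixes s t :: real
  assumes "t \<le> s" "2 \<le> s + t"
  shows "(2 * s - 1) / (2 * (s + t - 1)) \<le> s / (s + t) + (s - t) / (s + t)\<^sup>2"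
proof -
  define n where "n = s + t"
  have n: "2 \<le> n" using assms by (simp add: n_def)
  have "(2 * s - 1) / (2 * (n - 1)) = s / n + (2 * s - n) / (2 * n * (n - 1))"
    using n by (simp add: divide_simps) (simp add: algebra_simps)
  also have "(2 * s - n) / (2 * n * (n - 1)) \<le> (2 * s - n) / n\<^sup>2"
  proof (rule divide_left_mono)
    show "n\<^sup>2 \<le> 2 * n * (n - 1)"
      using mult_nonneg_nonneg[of n "n - 2"] n by (simp add: power2_eq_square algebra_simps)
  qed (use n assms in \<open>auto simp: n_def\<close>)
  also have "2 * s - n = s - t" by (simp add: n_def)
  finally show ?thesis by (simp add: n_def)
qed

theorem corollary1p14:
  fixes s t :: real
  assumes "1 \<le> t" and "t \<le> s" and "s + t \<ge> 3"
  shows "s / (s + t) \<le> beta_median s t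
    \<and> beta_median s t \<le> s / (s + t) + (s - t) / (s + t)\<^sup>2"
proof
  show "s / (s + t) \<le> beta_median s t"
    using assms by (intro le_beta_medianI reg_inc_beta_mean_le) auto
  have "beta_median s t \<le> (2 * s - 1) / (2 * (s + t - 1))"
    using assms by (intro beta_median_leI reg_inc_beta_arcsine_mode_ge) auto
  also have "\<dots> \<le> s / (s + t) + (s - t) / (s + t)\<^sup>2"
    using assms by (intro arcsine_mode_le) auto
  finally show "beta_median s t \<le> s / (s + t) + (s - t) / (s + t)\<^sup>2" .
qed

end
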